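(* Let $X$ be a set, $f:X\to X$ a self-map, and equip $X$ with the primal topology $\tau_f$ induced by $f$. Let $\sim$ be the equivalence relation on $X$ given by $x\sim y$ if and only if there are $m,n\in\mathbb{N}$ with $f^m(x)=f^n(y)$, and let $C\in X/\sim$ be an equivalence class. Then: (i) $C$ is invariant by $f$, i.e. $f(C)\subseteq C$. (ii) $C$ cannot contain two different periodic orbits. (iii) If $C$ contains the periodic orbit $\mathcal{O}(x)$, then for all $y\in C$ there exists $n\in\mathbb{N}$ such that $f^n(y)=x$. In particular, $R(f|_C)=\mathcal{O}(x)$ and $\omega(y)=\mathcal{O}(x)$ for all $y\in C$. (iv) If $C$ does not contain any periodic orbit, then for all $x,y\in C$ there exists $n\in\mathbb{N}$ such that $f^k(y)\notin V(x)$ for all $k\ge n$. In particular, $R(f|_C)=\emptyset$ and $\omega(x)=\emptyset$ for all $x\in C$. (v) $R(f)=\bigcup\{\omega(x): x\in X\}$, and this set is the set of all periodic points of $f$. (vi) A set $\Lambda\subseteq X$ is a minimal set of $f$ if and only if it is a periodic orbit of $f$.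
   Context: $\mathbb{N}$ is the set of non-negative integers and $\mathbb{Z}^+$ the set of positive integers. The primal topology induced by $f$ on $X$ is $\tau_f=\{A\subseteq X: f^{-1}(A)\subseteq A\}$; it is closed under arbitrary intersections, and $V(x)=\{y\in X:\exists k\in\mathbb{N},\ f^k(y)=x\}$ is the smallest open set containing $x$. The equivalence classes of $\sim$ are the connected components of $(X,\tau_f)$. The orbit of $x$ is $\mathcal{O}(x)=\{f^k(x):k\in\mathbb{N}\}$; $x$ is periodic if $f^k(x)=x$ for some $k\in\mathbb{Z}^+$, and then $\mathcal{O}(x)$ is called a periodic orbit. $R(f)$ is the set of recurrent points of $f$, where $x$ is recurrent if $\{k\in\mathbb{N}: f^k(x)\in U\}$ is infinite for every neighborhood $U$ of $x$; $R(f|_C)$ is the corresponding set for the restriction $f|_C:C\to C$ with $C$ carrying the subspace topology. The limit set of $x$ is $\omega(x)=\bigcap\{\overline{\mathcal{O}(f^k(x))}: k\in\mathbb{N}\}$. A set $\Lambda\subseteq X$ is a minimal set of $f$ if it is non-empty, closed, satisfies $f(\Lambda)\subseteq\Lambda$, and contains no proper subset that is non-empty, closed and invariant by $f$. *)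

theory Defs
  imports "HOL-Analysis.Abstract_Topology" "HOL-Library.FuncSet"
begin

definition primal_topology :: "'a set \<Rightarrow> ('a \<Rightarrow> 'a) \<Rightarrow> 'a topology" where
  "primal_topology X f = topology (\<lambda>A. A \<subseteq> X \<and> f -` A \<inter> X \<subseteq> A)"

lemma istopology_primal: "istopology (\<lambda>A. A \<subseteq> X \<and> f -` A \<inter> X \<subseteq> A)"
  unfolding istopology_def by blast

lemma openin_primal_topology:
  "openin (primal_topology X f) A \<longleftrightarrow> A \<subseteq> X \<and> f -` A \<inter> X \<subseteq> A"
  unfolding primal_topology_def topology_inverse'[OF istopology_primal] ..

lemma topspace_primal_topology [simp]: "topspace (primal_topology X f) = X"
  unfolding topspace_def openin_primal_topology by blast

definition eventual_rel :: "'a set \<Rightarrow> ('a \<Rightarrow> 'a) \<Rightarrow> ('a \<times> 'a) set" where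
  "eventual_rel X f = {(x, y) \<in> X \<times> X. \<exists>m n. (f ^^ m) x = (f ^^ n) y}"

lemma equiv_eventual_rel: "equiv X (eventual_rel X f)"
proof (rule equivI)
  show "eventual_rel X f \<subseteq> X \<times> X"
    unfolding eventual_rel_def by blast
  show "refl_on X (eventual_rel X f)"
    unfolding refl_on_def eventual_rel_def by auto
  show "sym (eventual_rel X f)"
    unfolding sym_def eventual_rel_def by (auto, metis)
  show "trans (eventual_rel X f)"
  proof (rule transI)
    fix x y z
    assume "(x, y) \<in> eventual_rel X f" "(y, z) \<in> eventual_rel X f"
    then obtain m n p q where *: "x \<in> X" "z \<in> X"
      "(f ^^ m) x = (f ^^ n) y" "(f ^^ p) y = (f ^^ q) z"
      unfolding eventual_rel_def by blast
    have "(f ^^ (p + m)) x = (f ^^ (p + n)) y"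
      using * by (simp add: funpow_add)
    also have "\<dots> = (f ^^ (n + q)) z"
      using * by (simp add: add.commute[of p] funpow_add)
    finally show "(x, z) \<in> eventual_rel X f"
      using * unfolding eventual_rel_def by blast
  qed
qed

definition backward_orbit :: "'a set \<Rightarrow> ('a \<Rightarrow> 'a) \<Rightarrow> 'a \<Rightarrow> 'a set" where
  "backward_orbit X f x = {y \<in> X. \<exists>k. (f ^^ k) y = x}"

text \<open>Unlike the orbits of \<open>HOL-Combinatorics.Orbits\<close>, the orbit of a point
  always contains the point itself.\<close>

definition forward_orbit :: "('a \<Rightarrow> 'a) \<Rightarrow> 'a \<Rightarrow> 'a set" where
  "forward_orbit f x = {(f ^^ k) x | k. True}"

definition periodic_points :: "'a set \<Rightarrow> ('a \<Rightarrow> 'a) \<Rightarrow> 'a set" where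
  "periodic_points X f = {x \<in> X. \<exists>k>0. (f ^^ k) x = x}"

definition periodic_orbit :: "'a set \<Rightarrow> ('a \<Rightarrow> 'a) \<Rightarrow> 'a set \<Rightarrow> bool" where
  "periodic_orbit X f P \<longleftrightarrow> (\<exists>x\<in>periodic_points X f. P = forward_orbit f x)"

definition neighbourhood_in :: "'a topology \<Rightarrow> 'a \<Rightarrow> 'a set \<Rightarrow> bool" where
  "neighbourhood_in T x U \<longleftrightarrow> U \<subseteq> topspace T \<and> (\<exists>W. openin T W \<and> x \<in> W \<and> W \<subseteq> U)"

definition recurrent_points :: "'a topology \<Rightarrow> ('a \<Rightarrow> 'a) \<Rightarrow> 'a set" where
  "recurrent_points T f =
     {x \<in> topspace T. \<forall>U. neighbourhood_in T x U \<longrightarrow> infinite {k. (f ^^ k) x \<in> U}}"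

definition limit_set :: "'a topology \<Rightarrow> ('a \<Rightarrow> 'a) \<Rightarrow> 'a \<Rightarrow> 'a set" where
  "limit_set T f x = (\<Inter>k. T closure_of (forward_orbit f ((f ^^ k) x)))"

definition minimal_set :: "'a topology \<Rightarrow> ('a \<Rightarrow> 'a) \<Rightarrow> 'a set \<Rightarrow> bool" where
  "minimal_set T f L \<longleftrightarrow>
     L \<noteq> {} \<and> closedin T L \<and> f ` L \<subseteq> L \<and>
     \<not> (\<exists>M. M \<subset> L \<and> M \<noteq> {} \<and> closedin T M \<and> f ` M \<subseteq> M)"

end

theory Submission
  imports Defs
begin

text \<open>The closed sets of the primal topology are exactly the invariant sets, so forward orbits are
  closed and the limit set of \<open>y\<close> consists of the periodic points on the orbit of \<open>y\<close>. Since the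
  backward orbit of a point is its smallest neighbourhood, a recurrent point is the same as a
  periodic one. An equivalence class is both forward and backward invariant, so its subspace topology
  is again primal, and any two points of it share a common iterate.\<close>

section \<open>Iterates and periodic points\<close>

lemma funpow_in_carrier:
  assumes "f \<in> X \<rightarrow> X" "x \<in> X"
  shows "(f ^^ k) x \<in> X"
  using assms by (induction k) auto

lemma funpow_multiple_period:
  assumes "(f ^^ k) x = x"
  shows "(f ^^ (k * m)) x = x"
  using assms by (induction m) (simp_all add: funpow_add)

text \<open>With period \<open>k > 0\<close>, going round the cycle \<open>m\<close> times takes
  \<open>k * m \<ge> m\<close> steps. After the first \<open>m\<close> of them, the remaining
  \<open>k * m - m\<close> lead back to \<open>x\<close>.\<close>

lemma funpow_return:
  assumes "x \<in> periodic_points X f"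
  shows "\<exists>j. (f ^^ j) ((f ^^ m) x) = x"
proof -
  obtain k where k: "k > 0" "(f ^^ k) x = x"
    using assms unfolding periodic_points_def by blast
  then have "k * m - m + m = k * m"
    by simp
  then have "(f ^^ (k * m - m)) ((f ^^ m) x) = x"
    using funpow_multiple_period[OF k(2)] by (metis comp_apply funpow_add)
  then show ?thesis ..
qed

lemma funpow_periodic_points:
  assumes "f \<in> X \<rightarrow> X" "x \<in> periodic_points X f"
  shows "(f ^^ m) x \<in> periodic_points X f"
proof -
  obtain k where "x \<in> X" "k > 0" "(f ^^ k) x = x"
    using assms unfolding periodic_points_def by blast
  moreover from this have "(f ^^ k) ((f ^^ m) x) = (f ^^ m) x"
    by (metis add.commute comp_apply funpow_add)
  ultimately show ?thesis
    using funpow_in_carrier[OF assms(1)] unfolding periodic_points_def by blast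
qed

text \<open>Two visits to \<open>x\<close> at different times make their difference a positive
  return time.\<close>

lemma periodic_pointsI:
  assumes "x \<in> X" "(f ^^ a) y = x" "(f ^^ b) y = x" "a < b"
  shows "x \<in> periodic_points X f"
proof -
  have "(f ^^ (b - a)) x = (f ^^ (b - a + a)) y"
    using assms(2) by (simp add: funpow_add)
  also have "\<dots> = x"
    using assms by simp
  finally show ?thesis
    using assms(1,4) unfolding periodic_points_def by (auto intro: exI[of _ "b - a"])
qed

section \<open>Forward orbits, closed sets and limit sets\<close>

lemma forward_orbit_self: "x \<in> forward_orbit f x"
  unfolding forward_orbit_def by (auto intro: exI[of _ 0])

lemma forward_orbit_subset:
  assumes "f ` A \<subseteq> A" "x \<in> A"
  shows "forward_orbit f x \<subseteq> A"
  using funpow_in_carrier[of f A x] assms unfolding forward_orbit_def by auto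

lemma forward_orbit_invariant: "f ` forward_orbit f x \<subseteq> forward_orbit f x"
  unfolding forward_orbit_def by (auto intro: exI[of _ "Suc _"])

lemma forward_orbit_sym:
  assumes "x \<in> periodic_points X f" "z \<in> forward_orbit f x"
  shows "x \<in> forward_orbit f z"
proof -
  obtain m where m: "z = (f ^^ m) x"
    using assms(2) unfolding forward_orbit_def by blast
  obtain j where "(f ^^ j) z = x"
    using funpow_return[OF assms(1)] m by blast
  then show ?thesis
    unfolding forward_orbit_def by blast
qed

text \<open>Complementation turns backward invariance into forward invariance: \<open>X - A\<close>
  is open iff no point of \<open>A\<close> is sent into \<open>X - A\<close>, and \<open>f\<close>
  does not leave \<open>X\<close>.\<close>

lemma closedin_primal_topology:
  assumes "f \<in> X \<rightarrow> X"
  shows "closedin (primal_topology X f) A \<longleftrightarrow> A \<subseteq> X \<and> f ` A \<subseteq> A"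
  using assms unfolding closedin_def openin_primal_topology by auto

lemma closedin_forward_orbit:
  assumes "f \<in> X \<rightarrow> X" "x \<in> X"
  shows "closedin (primal_topology X f) (forward_orbit f x)"
proof -
  have "forward_orbit f x \<subseteq> X"
    using assms by (intro forward_orbit_subset) auto
  then show ?thesis
    using forward_orbit_invariant closedin_primal_topology[OF assms(1)] by metis
qed

lemma limit_set_primal_topology:
  assumes f: "f \<in> X \<rightarrow> X" and y: "y \<in> X"
  shows "limit_set (primal_topology X f) f y = forward_orbit f y \<inter> periodic_points X f"
proof -
  have "limit_set (primal_topology X f) f y = (\<Inter>k. forward_orbit f ((f ^^ k) y))"
    unfolding limit_set_def
    using closedin_forward_orbit[OF f funpow_in_carrier[OF f y]] by (simp add: closure_of_closedin)
  also have "\<dots> = forward_orbit f y \<inter> periodic_points X f"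
  proof (intro equalityI subsetI)
    fix z assume z: "z \<in> (\<Inter>k. forward_orbit f ((f ^^ k) y))"
    then have "z \<in> forward_orbit f ((f ^^ 0) y)"
      by blast
    then have zy: "z \<in> forward_orbit f y"
      by simp
    then obtain a where a: "(f ^^ a) y = z"
      unfolding forward_orbit_def by auto
    \<comment> \<open>The shift by \<open>Suc a\<close> forces a visit to \<open>z\<close> strictly
      later than the one at time \<open>a\<close>.\<close>
    from z have "z \<in> forward_orbit f ((f ^^ Suc a) y)"
      by blast
    then obtain j where j: "(f ^^ (j + Suc a)) y = z"
      unfolding forward_orbit_def funpow_add by auto
    have "z \<in> X"
      using a funpow_in_carrier[OF f y] by blast
    then have "z \<in> periodic_points X f"
      using a j by (rule periodic_pointsI) simp
    with zy show "z \<in> forward_orbit f y \<inter> periodic_points X f"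
      by blast
  next
    fix z assume z: "z \<in> forward_orbit f y \<inter> periodic_points X f"
    then obtain a where a: "(f ^^ a) y = z"
      unfolding forward_orbit_def by auto
    from z have zp: "z \<in> periodic_points X f" ..
    \<comment> \<open>From \<open>(f ^^ k) y\<close>, the first \<open>a\<close> steps lead to
      \<open>(f ^^ k) z\<close>, a point on the cycle of \<open>z\<close>, from which
      \<open>z\<close> is reached again.\<close>
    have "z \<in> forward_orbit f ((f ^^ k) y)" for k
    proof -
      obtain j where "(f ^^ j) ((f ^^ k) z) = z"
        using funpow_return[OF zp] by blast
      then have "(f ^^ (j + a)) ((f ^^ k) y) = z"
        using a by (metis add.assoc add.commute comp_apply funpow_add)
      then show ?thesis
        unfolding forward_orbit_def by blast
    qed
    then show "z \<in> (\<Inter>k. forward_orbit f ((f ^^ k) y))"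
      by blast
  qed
  finally show ?thesis .
qed

section \<open>Recurrent points and subspaces\<close>

lemma openin_backward_orbit: "openin (primal_topology X f) (backward_orbit X f x)"
  unfolding openin_primal_topology backward_orbit_def
  by (auto simp: funpow_swap1 intro: exI[of _ "Suc _"])

lemma recurrent_points_primal_topology:
  assumes f: "f \<in> X \<rightarrow> X"
  shows "recurrent_points (primal_topology X f) f = periodic_points X f"
proof (intro equalityI subsetI)
  fix x assume x: "x \<in> recurrent_points (primal_topology X f) f"
  then have xX: "x \<in> X"
    unfolding recurrent_points_def by simp
  have "x \<in> backward_orbit X f x"
    using xX unfolding backward_orbit_def by (auto intro: exI[of _ 0])
  then have "neighbourhood_in (primal_topology X f) x (backward_orbit X f x)"
    using openin_backward_orbit[of X f x]
    unfolding neighbourhood_in_def by (auto simp: openin_primal_topology)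
  with x have "infinite {k. (f ^^ k) x \<in> backward_orbit X f x}"
    unfolding recurrent_points_def by blast
  \<comment> \<open>Infinitely many return times include a positive one. Time 0 would only give the
    trivial return.\<close>
  then obtain k where k: "k > 0" "(f ^^ k) x \<in> backward_orbit X f x"
    unfolding infinite_nat_iff_unbounded by blast
  then obtain j where "(f ^^ (j + k)) x = x"
    unfolding backward_orbit_def funpow_add by auto
  then show "x \<in> periodic_points X f"
    using k xX unfolding periodic_points_def by auto
next
  fix x assume "x \<in> periodic_points X f"
  then obtain k where k: "x \<in> X" "k > 0" "(f ^^ k) x = x"
    unfolding periodic_points_def by blast
  \<comment> \<open>All multiples of the period are return times, whatever set around
    \<open>x\<close> is considered.\<close>
  have "infinite (range ((*) k))"
    using k by (intro range_inj_infinite) (auto simp: inj_on_def)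
  moreover have "range ((*) k) \<subseteq> {n. (f ^^ n) x \<in> U}" if "x \<in> U" for U
    using funpow_multiple_period[OF k(3)] that by auto
  ultimately have "infinite {n. (f ^^ n) x \<in> U}" if "x \<in> U" for U
    using that finite_subset by blast
  then show "x \<in> recurrent_points (primal_topology X f) f"
    using k(1) unfolding recurrent_points_def neighbourhood_in_def by auto
qed

text \<open>Backward invariance of \<open>C\<close> makes a set that is open for the primal topology
  of \<open>C\<close> already open in \<open>X\<close>, since all preimages in \<open>X\<close> of
  its points lie in \<open>C\<close>.\<close>

lemma subtopology_primal_topology:
  assumes "C \<subseteq> X" "f -` C \<inter> X \<subseteq> C"
  shows "subtopology (primal_topology X f) C = primal_topology C f"
proof (rule topology_eq[THEN iffD2], intro allI iffI)
  fix A assume "openin (subtopology (primal_topology X f) C) A"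
  then show "openin (primal_topology C f) A"
    using assms unfolding openin_subtopology openin_primal_topology by auto
next
  fix A assume "openin (primal_topology C f) A"
  then have "openin (primal_topology X f) A" "A \<inter> C = A"
    using assms unfolding openin_primal_topology by blast+
  then show "openin (subtopology (primal_topology X f) C) A"
    unfolding openin_subtopology by metis
qed

text \<open>\<open>restrict f C\<close> is \<open>undefined\<close> outside \<open>C\<close>, but
  openness in \<open>C\<close> only tests the values of the map on \<open>C\<close>.\<close>

lemma primal_topology_restrict: "primal_topology C (restrict f C) = primal_topology C f"
  by (rule topology_eq[THEN iffD2]) (auto simp: openin_primal_topology)

lemma funpow_restrict:
  assumes "f \<in> C \<rightarrow> C" "x \<in> C"
  shows "(restrict f C ^^ k) x = (f ^^ k) x"
  using funpow_in_carrier[OF assms] by (induction k) auto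

lemma recurrent_points_subtopology:
  assumes "C \<subseteq> X" "f -` C \<inter> X \<subseteq> C" "f \<in> C \<rightarrow> C"
  shows "recurrent_points (subtopology (primal_topology X f) C) (restrict f C)
    = C \<inter> periodic_points X f"
proof -
  have "recurrent_points (subtopology (primal_topology X f) C) (restrict f C)
      = recurrent_points (primal_topology C (restrict f C)) (restrict f C)"
    by (simp only: subtopology_primal_topology[OF assms(1,2)] primal_topology_restrict)
  also have "\<dots> = periodic_points C (restrict f C)"
    using assms(3) by (intro recurrent_points_primal_topology) auto
  also have "\<dots> = C \<inter> periodic_points X f"
    using assms(1) funpow_restrict[OF assms(3)] unfolding periodic_points_def by auto
  finally show ?thesis .
qed

section \<open>Minimal sets\<close>

lemma minimal_set_primal_topology:
  assumes f: "f \<in> X \<rightarrow> X"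
  shows "minimal_set (primal_topology X f) f L \<longleftrightarrow> periodic_orbit X f L"
proof
  assume L: "minimal_set (primal_topology X f) f L"
  then obtain x where x: "x \<in> L"
    unfolding minimal_set_def by blast
  have inv: "f ` L \<subseteq> L" and LX: "L \<subseteq> X"
    using L closedin_subset unfolding minimal_set_def by fastforce+
  \<comment> \<open>The orbit of any point of \<open>L\<close> is a non-empty closed invariant
    subset, so minimality makes it all of \<open>L\<close>.\<close>
  have orbit: "forward_orbit f z = L" if "z \<in> L" for z
  proof -
    have "forward_orbit f z \<subseteq> L" "closedin (primal_topology X f) (forward_orbit f z)"
      using that LX forward_orbit_subset[OF inv] closedin_forward_orbit[OF f] by auto
    moreover have "forward_orbit f z \<noteq> {}"
      using forward_orbit_self[of z f] by blast
    ultimately show ?thesis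
      using L forward_orbit_invariant[of f z] unfolding minimal_set_def by (metis psubsetI)
  qed
  \<comment> \<open>Starting from \<open>f x\<close> instead of \<open>x\<close> makes the return
    time \<open>Suc k\<close> positive.\<close>
  have "x \<in> forward_orbit f (f x)"
    using orbit x inv by auto
  then obtain k where "x = (f ^^ k) (f x)"
    unfolding forward_orbit_def by blast
  then have "(f ^^ Suc k) x = x"
    by (simp add: funpow_swap1)
  then have "x \<in> periodic_points X f"
    using x LX unfolding periodic_points_def by blast
  then show "periodic_orbit X f L"
    using orbit[OF x] unfolding periodic_orbit_def by blast
next
  assume "periodic_orbit X f L"
  then obtain x where x: "x \<in> periodic_points X f" "L = forward_orbit f x"
    unfolding periodic_orbit_def by blast
  then have xX: "x \<in> X"
    unfolding periodic_points_def by blast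
  \<comment> \<open>Any point of \<open>M\<close> lies on the cycle and leads back to
    \<open>x\<close>, so the invariant set \<open>M\<close> contains the whole cycle.\<close>
  have "L \<subseteq> M" if M: "M \<subseteq> L" "M \<noteq> {}" "f ` M \<subseteq> M" for M
  proof -
    obtain z where z: "z \<in> M"
      using M by blast
    then have "z \<in> forward_orbit f x"
      using M(1) x(2) by blast
    with x(1) have "x \<in> forward_orbit f z"
      by (rule forward_orbit_sym)
    then have "x \<in> M"
      using forward_orbit_subset[OF M(3) z] by blast
    then show ?thesis
      using forward_orbit_subset[OF M(3)] x(2) by simp
  qed
  then show "minimal_set (primal_topology X f) f L"
    using x closedin_forward_orbit[OF f xX] forward_orbit_invariant[of f x]
      forward_orbit_self[of x f] unfolding minimal_set_def by blast
qed

text \<open>From every entry into the backward orbit of \<open>x\<close>, the orbit of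
  \<open>y\<close> goes on to hit \<open>x\<close>. Arbitrarily late entries would thus give two
  visits to \<open>x\<close>, making \<open>x\<close> periodic.\<close>

lemma eventually_outside_backward_orbit:
  assumes "x \<in> X" "x \<notin> periodic_points X f"
  shows "\<exists>n. \<forall>k\<ge>n. (f ^^ k) y \<notin> backward_orbit X f x"
proof (rule ccontr)
  assume "\<not> ?thesis"
  then have *: "\<exists>b\<ge>n. (f ^^ b) y = x" for n
    unfolding backward_orbit_def
    by (auto simp: funpow_add) (metis comp_apply funpow_add le_add2 le_trans)
  from *[of 0] obtain a where a: "(f ^^ a) y = x"
    by blast
  from *[of "Suc a"] obtain b where b: "a < b" "(f ^^ b) y = x"
    unfolding Suc_le_eq by blast
  show False
    using periodic_pointsI[OF assms(1) a b(2,1)] assms(2) by blast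
qed

section \<open>Equivalence classes\<close>

context
  fixes X :: "'a set" and f :: "'a \<Rightarrow> 'a" and C :: "'a set"
  assumes f: "f \<in> X \<rightarrow> X" and C: "C \<in> X // eventual_rel X f"
begin

lemma class_subset: "C \<subseteq> X"
  using C in_quotient_imp_subset[OF equiv_eventual_rel] by blast

text \<open>A point is always equivalent to its image. The equivalence yields forward and backward
  invariance of \<open>C\<close> at once.\<close>

lemma class_image_iff:
  assumes "x \<in> X"
  shows "f x \<in> C \<longleftrightarrow> x \<in> C"
proof -
  have "(f ^^ 1) x = (f ^^ 0) (f x)"
    by simp
  then have "(x, f x) \<in> eventual_rel X f"
    using assms f unfolding eventual_rel_def by blast
  then show ?thesis
    using C in_quotient_imp_closed[OF equiv_eventual_rel] equiv_eventual_rel[of X f]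
    by (metis equiv_def symE)
qed

lemma class_common_iterate:
  assumes "x \<in> C" "y \<in> C"
  obtains m n where "(f ^^ m) x = (f ^^ n) y"
  using in_quotient_imp_in_rel[OF equiv_eventual_rel C, of x y] assms
  unfolding eventual_rel_def by blast

text \<open>The common iterate of \<open>x\<close> and \<open>y\<close> lies on the cycle of
  \<open>x\<close>, hence continues to \<open>x\<close>.\<close>

lemma class_reaches_periodic_point:
  assumes "x \<in> periodic_points X f" "x \<in> C" "y \<in> C"
  shows "x \<in> forward_orbit f y"
proof -
  obtain m n where mn: "(f ^^ m) x = (f ^^ n) y"
    using class_common_iterate assms by blast
  obtain j where "(f ^^ j) ((f ^^ m) x) = x"
    using funpow_return[OF assms(1)] by blast
  then have "(f ^^ (j + n)) y = x"
    using mn by (simp add: funpow_add)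
  then show ?thesis
    unfolding forward_orbit_def by blast
qed

lemma class_periodic_points:
  assumes x: "x \<in> periodic_points X f" "x \<in> C"
  shows "C \<inter> periodic_points X f = forward_orbit f x"
proof
  show "C \<inter> periodic_points X f \<subseteq> forward_orbit f x"
    using class_reaches_periodic_point x by blast
  have "f ` C \<subseteq> C"
    using class_image_iff class_subset by blast
  then have "forward_orbit f x \<subseteq> C"
    using x(2) by (rule forward_orbit_subset)
  moreover have "forward_orbit f x \<subseteq> periodic_points X f"
    using funpow_periodic_points[OF f x(1)] unfolding forward_orbit_def by blast
  ultimately show "forward_orbit f x \<subseteq> C \<inter> periodic_points X f"
    by blast
qed

end

section \<open>Assembly of the six claims\<close>

theorem theorem8:
  fixes X :: "'a set" and f :: "'a \<Rightarrow> 'a" and C :: "'a set"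
  assumes "f \<in> X \<rightarrow> X"
    and "C \<in> X // eventual_rel X f"
  shows "f ` C \<subseteq> C
    \<and> (\<forall>P Q. periodic_orbit X f P \<longrightarrow> periodic_orbit X f Q
          \<longrightarrow> P \<subseteq> C \<longrightarrow> Q \<subseteq> C \<longrightarrow> P = Q)
    \<and> (\<forall>x\<in>periodic_points X f. forward_orbit f x \<subseteq> C \<longrightarrow>
          (\<forall>y\<in>C. \<exists>n. (f ^^ n) y = x)
        \<and> recurrent_points (subtopology (primal_topology X f) C) (restrict f C) = forward_orbit f x
        \<and> (\<forall>y\<in>C. limit_set (primal_topology X f) f y = forward_orbit f x))
    \<and> (\<not> (\<exists>P. periodic_orbit X f P \<and> P \<subseteq> C) \<longrightarrow>
          (\<forall>x\<in>C. \<forall>y\<in>C. \<exists>n. \<forall>k\<ge>n. (f ^^ k) y \<notin> backward_orbit X f x)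
        \<and> recurrent_points (subtopology (primal_topology X f) C) (restrict f C) = {}
        \<and> (\<forall>x\<in>C. limit_set (primal_topology X f) f x = {}))
    \<and> recurrent_points (primal_topology X f) f = (\<Union>x\<in>X. limit_set (primal_topology X f) f x)
    \<and> recurrent_points (primal_topology X f) f = periodic_points X f
    \<and> (\<forall>L\<subseteq>X. minimal_set (primal_topology X f) f L \<longleftrightarrow> periodic_orbit X f L)"
proof -
  note f = assms(1)
  note CX = class_subset[OF assms]
  have inv: "f ` C \<subseteq> C" and pre: "f -` C \<inter> X \<subseteq> C" and fC: "f \<in> C \<rightarrow> C"
    using class_image_iff[OF assms] CX by auto
  note periodic_C = class_periodic_points[OF assms]
  note recurrent_C = recurrent_points_subtopology[OF CX pre fC]
  have limit_C: "limit_set (primal_topology X f) f y = forward_orbit f y \<inter> periodic_points X f"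
    "forward_orbit f y \<subseteq> C" if "y \<in> C" for y
    using that limit_set_primal_topology[OF f] forward_orbit_subset[OF inv] CX by auto
  \<comment> \<open>Both orbits equal \<open>C \<inter> periodic_points X f\<close>.\<close>
  have unique: "\<forall>P Q. periodic_orbit X f P \<longrightarrow> periodic_orbit X f Q
      \<longrightarrow> P \<subseteq> C \<longrightarrow> Q \<subseteq> C \<longrightarrow> P = Q"
    using periodic_C forward_orbit_self unfolding periodic_orbit_def by (metis subsetD)
  have periodic_case: "(\<forall>y\<in>C. \<exists>n. (f ^^ n) y = x)
      \<and> recurrent_points (subtopology (primal_topology X f) C) (restrict f C) = forward_orbit f x
      \<and> (\<forall>y\<in>C. limit_set (primal_topology X f) f y = forward_orbit f x)"
    if x: "x \<in> periodic_points X f" "forward_orbit f x \<subseteq> C" for x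
  proof -
    have xC: "x \<in> C"
      using x(2) forward_orbit_self[of x f] by blast
    have reach: "x \<in> forward_orbit f y" if "y \<in> C" for y
      using class_reaches_periodic_point[OF assms x(1) xC that] .
    \<comment> \<open>The orbit of \<open>y\<close> stays in \<open>C\<close>, whose periodic points
      form the cycle of \<open>x\<close>; conversely it reaches \<open>x\<close> and so contains
      that cycle.\<close>
    have "forward_orbit f y \<inter> periodic_points X f = forward_orbit f x" if "y \<in> C" for y
      using periodic_C[OF x(1) xC] limit_C(2)[OF that]
        forward_orbit_subset[OF forward_orbit_invariant reach[OF that]] by blast
    moreover have "\<exists>n. (f ^^ n) y = x" if "y \<in> C" for y
      using reach[OF that] unfolding forward_orbit_def by auto
    ultimately show ?thesis
      using limit_C(1) recurrent_C periodic_C[OF x(1) xC] by simp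
  qed
  have aperiodic_case: "(\<forall>x\<in>C. \<forall>y\<in>C. \<exists>n. \<forall>k\<ge>n. (f ^^ k) y \<notin> backward_orbit X f x)
      \<and> recurrent_points (subtopology (primal_topology X f) C) (restrict f C) = {}
      \<and> (\<forall>x\<in>C. limit_set (primal_topology X f) f x = {})"
    if "\<not> (\<exists>P. periodic_orbit X f P \<and> P \<subseteq> C)"
  proof -
    \<comment> \<open>A periodic point in \<open>C\<close> would have its whole orbit in
      \<open>C\<close>.\<close>
    have none: "C \<inter> periodic_points X f = {}"
      using that limit_C(2) unfolding periodic_orbit_def by auto
    have "\<exists>n. \<forall>k\<ge>n. (f ^^ k) y \<notin> backward_orbit X f x" if "x \<in> C" for x y
      using that none CX by (intro eventually_outside_backward_orbit) auto
    then show ?thesis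
      using none recurrent_C limit_C by blast
  qed
  have "(\<Union>x\<in>X. limit_set (primal_topology X f) f x)
      = (\<Union>x\<in>X. forward_orbit f x \<inter> periodic_points X f)"
    using limit_set_primal_topology[OF f] by simp
  \<comment> \<open>Each periodic point lies on its own orbit, hence occurs in the union.\<close>
  also have "\<dots> = periodic_points X f"
    unfolding periodic_points_def by (auto intro: forward_orbit_self)
  finally show ?thesis
    using inv unique periodic_case aperiodic_case recurrent_points_primal_topology[OF f]
      minimal_set_primal_topology[OF f] by (intro conjI ballI allI impI) simp_all
qed

end
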